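(* Let $q$ be a complex number with $|q|<1$. Then the following three identities hold: \begin{align*} \sum_{i,j,k\ge 0}\frac{q^{\frac{3}{2}i^2+2j^2+4k^2+2ij+4ik+4jk-\frac{1}{2}i}}{(q;q)_i(q;q)_j(q^2;q^2)_k} &=\frac{(q^3,q^4,q^7;q^7)_\infty}{(q;q)_\infty},\\ \sum_{i,j,k\ge 0}\frac{q^{\frac{3}{2}i^2+2j^2+4k^2+2ij+4ik+4jk-\frac{1}{2}i+j}}{(q;q)_i(q;q)_j(q^2;q^2)_k} &=\frac{(q^2,q^5,q^7;q^7)_\infty}{(q;q)_\infty},\\ \sum_{i,j,k\ge 0}\frac{q^{\frac{3}{2}i^2+2j^2+4k^2+2ij+4ik+4jk+\frac{1}{2}i+2j+2k}}{(q;q)_i(q;q)_j(q^2;q^2)_k} &=\frac{(q,q^6,q^7;q^7)_\infty}{(q;q)_\infty}. \end{align*}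
   Context: For $|q|<1$: $(a;q)_\infty=\prod_{m=0}^\infty(1-aq^m)$, $(a;q)_n=(a;q)_\infty/(aq^n;q)_\infty=\prod_{m=0}^{n-1}(1-aq^m)$ for integers $n\ge0$, and $(a_1,\dots,a_r;q)_\infty=(a_1;q)_\infty\cdots(a_r;q)_\infty$; the same notation is used with the base $q$ replaced by a power of $q$. All exponents of $q$ in the sums are integers. *)

theory Defs
  imports "HOL-Analysis.Analysis"
begin

definition qpoch_inf :: "complex \<Rightarrow> complex \<Rightarrow> complex" where
  "qpoch_inf a q = (\<Prod>m. 1 - a * q ^ m)"

definition qpoch :: "complex \<Rightarrow> complex \<Rightarrow> nat \<Rightarrow> complex" where
  "qpoch a q n = (\<Prod>m<n. 1 - a * q ^ m)"

definition qpoch_inf_list :: "complex list \<Rightarrow> complex \<Rightarrow> complex" where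
  "qpoch_inf_list as q = (\<Prod>a\<leftarrow>as. qpoch_inf a q)"

lemma convergent_prod_qpoch:
  assumes "norm (q::complex) < 1"
  shows "convergent_prod (\<lambda>m. 1 - a * q ^ m)"
proof -
  have "summable (\<lambda>m. norm ((1 - a * q ^ m) - 1))"
    using assms by (simp add: norm_mult norm_power summable_mult)
  thus ?thesis
    by (intro abs_convergent_prod_imp_convergent_prod summable_imp_abs_convergent_prod)
qed

lemma qpoch_inf_split:
  assumes "norm q < 1"
  shows "qpoch_inf a q = qpoch a q n * qpoch_inf (a * q ^ n) q"
proof (induction n)
  case 0
  show ?case by (simp add: qpoch_def)
next
  case (Suc n)
  have "qpoch_inf (a * q ^ n) q = (1 - a * q ^ n) * qpoch_inf (a * q ^ Suc n) q"
  proof -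
    define f where "f = (\<lambda>m. 1 - a * q ^ n * q ^ m)"
    have conv: "convergent_prod f"
      unfolding f_def by (rule convergent_prod_qpoch[OF assms])
    have "(\<lambda>m. 1 - a * q ^ Suc n * q ^ m) has_prod qpoch_inf (a * q ^ Suc n) q"
      unfolding qpoch_inf_def
      by (intro convergent_prod_has_prod convergent_prod_qpoch assms)
    hence *: "(\<lambda>m. f (Suc m)) has_prod qpoch_inf (a * q ^ Suc n) q"
      by (simp add: f_def mult_ac)
    have "(\<lambda>m. \<Prod>i\<le>m. f (Suc i)) \<longlonglongrightarrow> qpoch_inf (a * q ^ Suc n) q"
      using * by (rule has_prod_imp_tendsto)
    hence "(\<lambda>m. f 0 * (\<Prod>i\<le>m. f (Suc i))) \<longlonglongrightarrow> f 0 * qpoch_inf (a * q ^ Suc n) q"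
      by (intro tendsto_intros)
    moreover have "f 0 * (\<Prod>i\<le>m. f (Suc i)) = (\<Prod>i\<le>Suc m. f i)" for m
      by (simp only: prod.atMost_Suc_shift)
    moreover have "(\<lambda>m. \<Prod>i\<le>Suc m. f i) \<longlonglongrightarrow> prodinf f"
      using convergent_prod_has_prod[OF conv, THEN has_prod_imp_tendsto]
      by (rule LIMSEQ_Suc)
    ultimately have "prodinf f = f 0 * qpoch_inf (a * q ^ Suc n) q"
      using LIMSEQ_unique by auto
    thus ?thesis by (simp add: f_def qpoch_inf_def)
  qed
  thus ?case using Suc by (simp add: qpoch_def mult_ac)
qed

text \<open>
  The terms $\frac{3}{2} i^2 \mp \frac{1}{2} i$ occurring in the exponents are natural numbers;
  the truncating operations on \<^typ>\<open>nat\<close> below compute them exactly.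
\<close>

lemma real_exponent_minus: "real ((3 * i ^ 2 - i) div 2) = 3 / 2 * real i ^ 2 - 1 / 2 * real i"
proof -
  have "i \<le> 3 * i ^ 2" by (cases i) (auto simp: power2_eq_square)
  moreover have "even (3 * i ^ 2 - i)" by simp
  ultimately show ?thesis by (simp add: real_of_nat_div of_nat_diff diff_divide_distrib)
qed

lemma real_exponent_plus: "real ((3 * i ^ 2 + i) div 2) = 3 / 2 * real i ^ 2 + 1 / 2 * real i"
proof -
  have "even (3 * i ^ 2 + i)" by simp
  thus ?thesis by (simp add: real_of_nat_div add_divide_distrib)
qed

end

theory Submission
  imports Defs
begin

text \<open>
  With \<open>r = i + j + 2 k\<close> the three exponents are
  \<open>r\<^sup>2 + a r + i (i - 1) / 2 + j\<^sup>2 + b j\<close> for \<open>(a, b) = (0, 0), (0, 1), (1, 1)\<close>. For fixed \<open>r\<close> and \<open>j\<close>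
  the sum over \<open>i + 2 k = r - j\<close> collapses, because \<open>(-x; q)\<^sub>\<infinity> / (x\<^sup>2; q\<^sup>2)\<^sub>\<infinity> = 1 / (x; q)\<^sub>\<infinity>\<close>; comparing
  coefficients gives \<open>1 / (q; q)\<^bsub>r - j\<^esub>\<close> (\<open>inv_qfact_convolution\<close>). The triple sums thus become the
  double sums
  \<open>\<Sum>\<^sub>r q\<^bsup>r\<^sup>2 + a r\<^esup> \<Sum>\<^sub>j q\<^bsup>j\<^sup>2 + b j\<^esup> / ((q; q)\<^bsub>r - j\<^esub> (q; q)\<^sub>j)\<close> of the Andrews-Gordon identities modulo 7.

  These are proved by a bilateral Bailey chain. For a sequence \<open>A\<close> on the integers put
  \<open>B\<^sub>N = \<Sum>\<^sub>m A\<^sub>m / ((q; q)\<^bsub>N - m\<^esub> (q; q)\<^bsub>N + m\<^esub>)\<close> (\<open>bailey_sum\<close>). Two moves act on such pairs.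
  The Bailey step (\<open>bailey_step\<close>) multiplies \<open>A\<^sub>m\<close> by \<open>q\<^bsup>m\<^sup>2\<^esup>\<close> and replaces \<open>B\<^sub>N\<close> by
  \<open>\<Sum>\<^sub>s q\<^bsup>s\<^sup>2\<^esup> B\<^sub>s / (q; q)\<^bsub>N - s\<^esub>\<close>; it is a form of the q-Vandermonde sum. The lift (\<open>bailey_lift\<close>)
  multiplies \<open>B\<^sub>N\<close> by \<open>q\<^sup>N\<close> and, for the theta sequences
  \<open>A\<^sub>m = (-x)\<^sup>m Q\<^bsup>m (m - 1) / 2\<^esup>\<close> with \<open>x = Q / q\<close>, changes \<open>x\<close> to \<open>Q\<close>; it holds because the difference
  of the two sides is a sum whose terms are antisymmetric under \<open>m \<mapsto> -1 - m\<close>.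
  Together with the symmetry \<open>x \<mapsto> Q / x\<close>, the lift also forces the sums for \<open>x = Q = q\<close> to vanish for
  \<open>N > 0\<close>, which is the start of the chain. Two steps lead to \<open>Q = q\<^sup>5\<close> and to the inner sums over \<open>j\<close>, the
  lift being inserted where a linear term \<open>b j\<close> or \<open>a r\<close> is wanted. The last step is taken in the limit
  \<open>N \<longlonglongrightarrow> \<infinity>\<close> (\<open>bailey_limit\<close>), which turns the double sum into a theta series with \<open>Q = q\<^sup>7\<close>.

  The Jacobi triple product (\<open>jacobi_triple_product\<close>) evaluates that series. Its finite form again
  concerns a \<open>bailey_sum\<close>, this time in base \<open>Q\<close> itself, so both limits are instances of one lemma,
  \<open>bailey_sum_tendsto\<close>. The chain divides by powers of \<open>q\<close>, and \<open>q = 0\<close> is treated separately: then only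
  the term \<open>i = j = k = 0\<close> remains.
\<close>

section \<open>Reciprocal q-factorials\<close>

text \<open>
  The reciprocal of \<open>(q; q)\<^sub>n\<close>, extended by \<open>0\<close> to negative \<open>n\<close>. This is the extension for which the
  recurrence \<open>inv_qfact_rec\<close> holds at every integer, so that finite sums can be shifted without boundary
  terms.
\<close>
definition inv_qfact :: "complex \<Rightarrow> int \<Rightarrow> complex" where
  "inv_qfact q n = (if n < 0 then 0 else 1 / qpoch q q (nat n))"

lemma one_minus_power_nonzero:
  fixes q :: complex
  assumes "norm q < 1" "n > 0"
  shows "1 - q ^ n \<noteq> 0"
proof
  assume "1 - q ^ n = 0"
  hence "norm (q ^ n) = 1" by simp
  moreover have "norm (q ^ n) < 1"
    using assms by (simp add: norm_power power_less_one_iff)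
  ultimately show False by simp
qed

lemma qpoch_nonzero: "norm q < 1 \<Longrightarrow> qpoch q q n \<noteq> 0"
  using one_minus_power_nonzero[of q "Suc m" for m] by (auto simp: qpoch_def)

lemma inv_qfact_neg [simp]: "n < 0 \<Longrightarrow> inv_qfact q n = 0"
  by (simp add: inv_qfact_def)

lemma inv_qfact_0 [simp]: "inv_qfact q 0 = 1"
  by (simp add: inv_qfact_def qpoch_def)

lemma inv_qfact_nat: "inv_qfact q (int n) = 1 / qpoch q q n"
  by (simp add: inv_qfact_def)

lemma inv_qfact_rec_nat:
  assumes "norm q < 1"
  shows "(1 - q ^ Suc n) * inv_qfact q (int (Suc n)) = inv_qfact q (int n)"
  unfolding inv_qfact_nat
  using qpoch_nonzero[OF assms, of n] one_minus_power_nonzero[OF assms, of "Suc n"]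
  by (simp add: qpoch_def)

lemma inv_qfact_rec:
  assumes "norm q < 1"
  shows "(1 - q powi n) * inv_qfact q n = inv_qfact q (n - 1)"
proof (cases "n > 0")
  case True
  then obtain k where k: "n = int (Suc k)"
    by (metis gr0_implies_Suc zero_less_imp_eq_int)
  have "q powi n = q ^ Suc k" by (simp only: k power_int_of_nat)
  thus ?thesis using inv_qfact_rec_nat[OF assms, of k] by (simp add: k)
next
  case False
  thus ?thesis by (cases "n = 0") auto
qed

section \<open>The Bailey step\<close>

text \<open>
  A limiting case of the q-Vandermonde sum. Splitting
  \<open>1 - q\<^bsup>M + 1\<^esup> = (1 - q\<^sup>t) + q\<^sup>t (1 - q\<^bsup>M + 1 - t\<^esup>)\<close>, which is the q-Pascal rule, expresses the sum for \<open>M + 1\<close>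
  and \<open>c\<close> by sums with \<open>M\<close> whose summands combine to those for \<open>c + 1\<close>. Hence the induction on \<open>M\<close> needs
  arbitrary \<open>c\<close>.
\<close>
lemma q_vandermonde:
  assumes q: "norm q < 1"
  shows "(\<Sum>t\<le>M. q ^ (t * (t + c)) * inv_qfact q (int M - int t) * inv_qfact q (int t) * inv_qfact q (int (c + t)))
           = inv_qfact q (int M) * inv_qfact q (int (M + c))"
proof (induction M arbitrary: c)
  case 0
  show ?case by simp
next
  case (Suc M)
  define r where "r = inv_qfact q"
  note rec = inv_qfact_rec_nat[OF q, folded r_def]
  define F where "F = (\<lambda>M c t. q ^ (t * (t + c)) * r (int M - int t) * r (int t) * r (int (c + t)))"
  have split: "(1 - q ^ Suc M) * F (Suc M) c t =
      q ^ (t * (t + c)) * q ^ t * r (int M - int t) * r (int t) * r (int (c + t))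
    + q ^ (t * (t + c)) * r (int (Suc M) - int t) * r (int t - 1) * r (int (c + t))"
    if t: "t \<le> Suc M" for t
  proof -
    have 1: "(1 - q ^ t) * r (int t) = r (int t - 1)"
      using inv_qfact_rec[OF q, of "int t"] by (simp add: r_def)
    have 2: "(1 - q ^ (Suc M - t)) * r (int (Suc M) - int t) = r (int M - int t)"
      using inv_qfact_rec[OF q, of "int (Suc M - t)"] t by (simp only: r_def power_int_of_nat) (simp add: of_nat_diff)
    have 3: "1 - q ^ Suc M = q ^ t * (1 - q ^ (Suc M - t)) + (1 - q ^ t)"
      using t by (simp add: algebra_simps flip: power_add)
    have "X * (e * A * B * C) = e * T * (Y * A) * B * C + e * A * (Z * B) * C"
      if "X = T * Y + Z" for X T Y Z e A B C :: complex
      unfolding that by (simp add: algebra_simps)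
    from this[OF 3] show ?thesis unfolding F_def 1[symmetric] 2[symmetric] .
  qed
  have "(1 - q ^ Suc M) * (\<Sum>t\<le>Suc M. F (Suc M) c t) =
      (\<Sum>t\<le>Suc M. q ^ (t * (t + c)) * q ^ t * r (int M - int t) * r (int t) * r (int (c + t)))
    + (\<Sum>t\<le>Suc M. q ^ (t * (t + c)) * r (int (Suc M) - int t) * r (int t - 1) * r (int (c + t)))"
    unfolding sum_distrib_left sum.distrib[symmetric] by (intro sum.cong refl split) auto
  also have "(\<Sum>t\<le>Suc M. q ^ (t * (t + c)) * q ^ t * r (int M - int t) * r (int t) * r (int (c + t)))
      = (\<Sum>t\<le>M. F M (Suc c) t * (1 - q ^ Suc (c + t)))"
  proof -
    have "(\<Sum>t\<le>Suc M. q ^ (t * (t + c)) * q ^ t * r (int M - int t) * r (int t) * r (int (c + t)))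
      = (\<Sum>t\<le>M. q ^ (t * (t + c)) * q ^ t * r (int M - int t) * r (int t) * r (int (c + t)))"
      by (simp add: r_def)
    also have "\<dots> = (\<Sum>t\<le>M. F M (Suc c) t * (1 - q ^ Suc (c + t)))"
    proof (intro sum.cong refl)
      fix t
      have "t * (t + Suc c) = t * (t + c) + t" by (simp add: algebra_simps)
      thus "q ^ (t * (t + c)) * q ^ t * r (int M - int t) * r (int t) * r (int (c + t))
          = F M (Suc c) t * (1 - q ^ Suc (c + t))"
        unfolding F_def using rec[of "c + t"] by (simp add: power_add mult_ac)
    qed
    finally show ?thesis .
  qed
  also have "(\<Sum>t\<le>Suc M. q ^ (t * (t + c)) * r (int (Suc M) - int t) * r (int t - 1) * r (int (c + t)))
     = (\<Sum>t\<le>M. F M (Suc c) t * q ^ Suc (c + t))"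
  proof -
    have "q ^ (Suc t * (Suc t + c)) * r (int (Suc M) - int (Suc t)) * r (int (Suc t) - 1) * r (int (c + Suc t))
        = F M (Suc c) t * q ^ Suc (c + t)" for t
    proof -
      have "Suc t * (Suc t + c) = t * (t + Suc c) + Suc (c + t)" by (simp add: algebra_simps)
      hence "q ^ (Suc t * (Suc t + c)) = q ^ (t * (t + Suc c)) * q ^ Suc (c + t)" by (simp only: power_add)
      moreover have "int (Suc M) - int (Suc t) = int M - int t" "int (Suc t) - 1 = int t" "c + Suc t = Suc c + t"
        by simp_all
      ultimately show ?thesis unfolding F_def by (simp only: mult_ac)
    qed
    moreover have "r (int 0 - 1) = 0" by (simp add: r_def)
    ultimately show ?thesis unfolding sum.atMost_Suc_shift by (simp only: mult_zero_left mult_zero_right add_0)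
  qed
  also have "(\<Sum>t\<le>M. F M (Suc c) t * (1 - q ^ Suc (c + t))) + \<dots> = (\<Sum>t\<le>M. F M (Suc c) t)"
    unfolding sum.distrib[symmetric] by (intro sum.cong refl) (simp add: algebra_simps)
  also have "\<dots> = r (int M) * r (int (M + Suc c))"
    using Suc[of "Suc c"] by (simp only: F_def r_def)
  also have "r (int M) = (1 - q ^ Suc M) * r (int (Suc M))" by (rule rec[symmetric])
  finally show ?case
    using one_minus_power_nonzero[OF q, of "Suc M"] by (simp add: F_def r_def del: power_Suc)
qed

lemma bailey_kernel_nonneg:
  assumes q: "norm q < 1"
  shows "(\<Sum>s\<le>N. q ^ s\<^sup>2 * inv_qfact q (int N - int s) * inv_qfact q (int s - int m) * inv_qfact q (int s + int m))
     = q ^ m\<^sup>2 * inv_qfact q (int N - int m) * inv_qfact q (int N + int m)"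
proof (cases "m \<le> N")
  case True
  define M where "M = N - m"
  have N: "N = m + M" using True by (simp add: M_def)
  have "(\<Sum>s\<le>N. q ^ s\<^sup>2 * inv_qfact q (int N - int s) * inv_qfact q (int s - int m) * inv_qfact q (int s + int m))
      = (\<Sum>s\<in>{m..m+M}. q ^ s\<^sup>2 * inv_qfact q (int N - int s) * inv_qfact q (int s - int m) * inv_qfact q (int s + int m))"
    by (rule sum.mono_neutral_right) (auto simp: N)
  also have "\<dots> = (\<Sum>t\<in>{0..M}. q ^ (t+m)\<^sup>2 * inv_qfact q (int N - int (t+m)) * inv_qfact q (int (t+m) - int m) * inv_qfact q (int (t+m) + int m))"
    by (rule sum.reindex_bij_witness[of _ "\<lambda>t. t + m" "\<lambda>s. s - m"]) auto
  also have "\<dots> = q ^ m\<^sup>2 * (\<Sum>t\<le>M. q ^ (t * (t + 2 * m)) * inv_qfact q (int M - int t) * inv_qfact q (int t) * inv_qfact q (int (2 * m + t)))"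
    unfolding sum_distrib_left atLeast0AtMost
  proof (intro sum.cong refl)
    fix t
    have "(t + m)\<^sup>2 = m\<^sup>2 + t * (t + 2 * m)" by (simp add: power2_eq_square algebra_simps)
    thus "q ^ (t + m)\<^sup>2 * inv_qfact q (int N - int (t + m)) * inv_qfact q (int (t + m) - int m) * inv_qfact q (int (t + m) + int m)
       = q ^ m\<^sup>2 * (q ^ (t * (t + 2 * m)) * inv_qfact q (int M - int t) * inv_qfact q (int t) * inv_qfact q (int (2 * m + t)))"
      by (simp add: N power_add algebra_simps)
  qed
  also have "\<dots> = q ^ m\<^sup>2 * inv_qfact q (int N - int m) * inv_qfact q (int N + int m)"
    by (subst q_vandermonde[OF q]) (simp add: N algebra_simps)
  finally show ?thesis .
next
  case False
  thus ?thesis by (auto intro!: sum.neutral)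
qed

text \<open>
  The single coefficient of the Bailey step. Only \<open>s \<ge> \<bar>m\<bar>\<close> contributes, and with \<open>s = \<bar>m\<bar> + t\<close> the sum is
  \<open>q_vandermonde\<close> for \<open>M = N - \<bar>m\<bar>\<close> and \<open>c = 2 \<bar>m\<bar>\<close>.
\<close>
lemma bailey_kernel:
  assumes q: "norm q < 1"
  shows "(\<Sum>s\<le>N. q ^ s\<^sup>2 * inv_qfact q (int N - int s) * (inv_qfact q (int s - m) * inv_qfact q (int s + m)))
     = q powi (m\<^sup>2) * (inv_qfact q (int N - m) * inv_qfact q (int N + m))"
proof (cases "m \<ge> 0")
  case True
  then obtain k where k: "m = int k" by (metis zero_le_imp_eq_int)
  have "q powi m\<^sup>2 = q ^ k\<^sup>2" unfolding k of_nat_power[symmetric] by (rule power_int_of_nat)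
  thus ?thesis using bailey_kernel_nonneg[OF q, of N k] by (simp add: k mult_ac)
next
  case False
  then obtain k where k: "m = - int k" by (metis nle_le zero_le_imp_eq_int minus_minus neg_0_le_iff_le)
  have "m\<^sup>2 = int (k\<^sup>2)" by (simp add: k)
  hence "q powi m\<^sup>2 = q ^ k\<^sup>2" by (simp only: power_int_of_nat)
  thus ?thesis using bailey_kernel_nonneg[OF q, of N k] by (simp add: k mult_ac)
qed

definition bailey_sum :: "complex \<Rightarrow> (int \<Rightarrow> complex) \<Rightarrow> nat \<Rightarrow> complex" where
  "bailey_sum q A N = (\<Sum>m = - int N..int N. A m * inv_qfact q (int N - m) * inv_qfact q (int N + m))"

lemma bailey_sum_extend:
  assumes "N \<le> K"
  shows "bailey_sum q A N = (\<Sum>m = - int K..int K. A m * inv_qfact q (int N - m) * inv_qfact q (int N + m))"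
  unfolding bailey_sum_def using assms
  by (intro sum.mono_neutral_left) (auto simp: not_le)

lemma bailey_step:
  assumes q: "norm q < 1"
  shows "(\<Sum>s\<le>N. q ^ s\<^sup>2 * inv_qfact q (int N - int s) * bailey_sum q A s)
     = bailey_sum q (\<lambda>m. q powi (m\<^sup>2) * A m) N"
proof -
  have "(\<Sum>s\<le>N. q ^ s\<^sup>2 * inv_qfact q (int N - int s) * bailey_sum q A s)
     = (\<Sum>s\<le>N. \<Sum>m = - int N..int N. A m * (q ^ s\<^sup>2 * inv_qfact q (int N - int s) * (inv_qfact q (int s - m) * inv_qfact q (int s + m))))"
    by (intro sum.cong refl) (simp add: bailey_sum_extend[of _ N] sum_distrib_left mult_ac)
  also have "\<dots> = (\<Sum>m = - int N..int N. A m * (\<Sum>s\<le>N. q ^ s\<^sup>2 * inv_qfact q (int N - int s) * (inv_qfact q (int s - m) * inv_qfact q (int s + m))))"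
    by (subst sum.swap) (simp add: sum_distrib_left)
  also have "\<dots> = bailey_sum q (\<lambda>m. q powi (m\<^sup>2) * A m) N"
    unfolding bailey_kernel[OF q] bailey_sum_def by (simp add: mult_ac)
  finally show ?thesis .
qed

section \<open>Theta sequences\<close>

text \<open>
  The general term of the theta series in Jacobi's triple product. Writing the quadratic exponent with
  \<open>m (m - 1) / 2\<close> keeps all exponents integral and makes the pair \<open>(x, Q)\<close> record the effect of every move
  of the chain.
\<close>
definition theta_term :: "complex \<Rightarrow> complex \<Rightarrow> int \<Rightarrow> complex" where
  "theta_term x q m = (- x) powi m * q powi (m * (m - 1) div 2)"

lemma even_mult_pred: "even (m * (m - 1))" for m :: int
  by simp

lemma theta_term_shift:
  assumes "q \<noteq> 0"
  shows "q powi (m\<^sup>2) * theta_term x Q m = theta_term (x * q) (Q * q ^ 2) m"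
proof -
  define t where "t = m * (m - 1) div 2"
  have "2 * t = m * (m - 1)" by (simp add: t_def)
  hence "m\<^sup>2 = m + 2 * t" by (simp add: power2_eq_square algebra_simps)
  hence "q powi (m\<^sup>2) = q powi m * (q ^ 2) powi t"
    using assms by (simp add: power_int_add power_int_mult)
  moreover have "(- (x * q)) powi m = (- x) powi m * q powi m"
    using power_int_mult_distrib[of "- x" q m] by simp
  ultimately show ?thesis by (simp add: theta_term_def power_int_mult_distrib mult_ac flip: t_def)
qed

lemma theta_term_uminus:
  assumes "q \<noteq> 0" "x \<noteq> 0"
  shows "theta_term x q (- m) = theta_term (q / x) q m"
proof -
  have "- m * (- m - 1) div 2 = m + m * (m - 1) div 2"
    using even_mult_pred[of m] by (simp add: algebra_simps)
  hence "q powi (- m * (- m - 1) div 2) = q powi m * q powi (m * (m - 1) div 2)"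
    using assms by (simp add: power_int_add)
  moreover have "(- x) powi (- m) * q powi m = (- (q / x)) powi m"
  proof -
    have "(- x) powi (- m) = (inverse (- x)) powi m"
      by (simp only: power_int_minus power_int_inverse)
    also have "\<dots> * q powi m = (inverse (- x) * q) powi m"
      by (rule power_int_mult_distrib[symmetric])
    also have "inverse (- x) * q = - (q / x)" using assms by (simp add: field_simps)
    finally show ?thesis .
  qed
  ultimately show ?thesis by (simp add: theta_term_def)
qed

lemma bailey_sum_theta_sym:
  assumes "q \<noteq> 0" "x \<noteq> 0"
  shows "bailey_sum b (theta_term x q) N = bailey_sum b (theta_term (q / x) q) N"
proof -
  have "(\<Sum>m = - int N..int N. theta_term x q m * inv_qfact b (int N - m) * inv_qfact b (int N + m))
      = (\<Sum>m = - int N..int N. theta_term x q (- m) * inv_qfact b (int N + m) * inv_qfact b (int N - m))"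
    by (rule sum.reindex_bij_witness[of _ uminus uminus]) auto
  thus ?thesis by (simp add: bailey_sum_def theta_term_uminus[OF assms] mult_ac)
qed

lemma theta_term_lift:
  assumes "q \<noteq> 0" 
  shows "theta_term Q Q m = q powi m * theta_term (Q / q) Q m"
  using assms by (simp add: theta_term_def power_int_mult_distrib[symmetric] flip: mult.assoc)

lemma theta_term_reflect:
  assumes "Q \<noteq> 0"
  shows "theta_term Q Q (- 1 - m) = - theta_term Q Q m"
proof -
  have *: "theta_term Q Q k = (-1) powi k * Q powi (k + k * (k - 1) div 2)" for k
    using assms power_int_mult_distrib[of "-1" Q k] by (simp add: theta_term_def power_int_add)
  have "(- 1 - m) + (- 1 - m) * ((- 1 - m) - 1) div 2 = m + m * (m - 1) div 2"
    using even_mult_pred[of m] even_mult_pred[of "- 1 - m"] by (simp add: algebra_simps)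
  moreover have "(-1 :: complex) powi (- 1 - m) = - ((-1) powi m)"
    using power_int_minus_one_minus[of "1 + m", where 'a = complex] by (simp add: power_int_add)
  ultimately show ?thesis unfolding * by (simp only: mult_minus_left)
qed

text \<open>
  Termwise, the difference of the two sides contains the factor
  \<open>q\<^sup>m - q\<^sup>N = q\<^sup>m (1 - q\<^bsup>N - m\<^esup>)\<close>, which shortens \<open>1 / (q; q)\<^bsub>N - m\<^esub>\<close> to \<open>1 / (q; q)\<^bsub>N - m - 1\<^esub>\<close>. The
  product \<open>1 / ((q; q)\<^bsub>N - 1 - m\<^esub> (q; q)\<^bsub>N + m\<^esub>)\<close> is invariant under \<open>m \<mapsto> -1 - m\<close>, while the theta term changes
  its sign, so the difference is its own negative.
\<close>
lemma bailey_lift: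
  assumes q: "norm q < 1" "q \<noteq> 0" "Q \<noteq> 0"
  shows "q ^ N * bailey_sum q (theta_term (Q / q) Q) N = bailey_sum q (theta_term Q Q) N"
proof -
  define r where "r = inv_qfact q"
  define f where "f = (\<lambda>m. theta_term Q Q m * r (int N - m - 1) * r (int N + m))"
  have "(\<Sum>m = - int N..int N - 1. f m) = (\<Sum>m = - int N..int N - 1. f (- 1 - m))"
    by (rule sum.reindex_bij_witness[of _ "\<lambda>m. - 1 - m" "\<lambda>m. - 1 - m"]) auto
  also have "\<dots> = - (\<Sum>m = - int N..int N - 1. f m)"
    unfolding sum_negf[symmetric] f_def theta_term_reflect[OF q(3)]
    by (intro sum.cong refl) (simp add: algebra_simps)
  finally have 0: "(\<Sum>m = - int N..int N - 1. f m) = 0" by simp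
  have "(\<Sum>m = - int N..int N. f m) = (\<Sum>m = - int N..int N - 1. f m)"
    by (rule sum.mono_neutral_right) (auto simp: f_def r_def)
  with 0 have 0: "(\<Sum>m = - int N..int N. f m) = 0" by simp
  have "bailey_sum q (theta_term Q Q) N - q ^ N * bailey_sum q (theta_term (Q / q) Q) N
      = (\<Sum>m = - int N..int N. f m)"
    unfolding bailey_sum_def sum_distrib_left sum_subtractf[symmetric]
  proof (rule sum.cong)
    fix m assume "m \<in> {- int N..int N}"
    have "q ^ N = q powi (m + (int N - m))" by simp
    also have "\<dots> = q powi m * q powi (int N - m)" using q by (subst power_int_add) auto
    finally have N: "q ^ N = q powi m * q powi (int N - m)" .
    have 1: "r (int N - m - 1) = (1 - q powi (int N - m)) * r (int N - m)"
      using inv_qfact_rec[OF q(1), of "int N - m"] by (simp add: r_def)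
    show "theta_term Q Q m * inv_qfact q (int N - m) * inv_qfact q (int N + m) -
         q ^ N * (theta_term (Q / q) Q m * inv_qfact q (int N - m) * inv_qfact q (int N + m)) = f m"
      unfolding f_def 1 unfolding theta_term_lift[OF q(2)] N r_def by (simp add: algebra_simps)
  qed auto
  with 0 show ?thesis by simp
qed

section \<open>The Bailey chain\<close>

text \<open>
  For \<open>Q = q\<close> the lift goes from \<open>x = 1\<close> to \<open>x = q\<close>, and the symmetry \<open>x \<mapsto> Q / x\<close> goes back. So the sum equals
  \<open>q\<^sup>N\<close> times itself.
\<close>
lemma bailey_sum_theta_base:
  assumes q: "norm q < 1" "q \<noteq> 0"
  shows "bailey_sum q (theta_term q q) N = (if N = 0 then 1 else 0)"
proof (cases "N = 0")
  case True
  thus ?thesis by (simp add: bailey_sum_def theta_term_def)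
next
  case False
  have "q ^ N * bailey_sum q (theta_term q q) N = bailey_sum q (theta_term q q) N"
    using bailey_lift[of q q N] bailey_sum_theta_sym[of q q q N] q by simp
  thus ?thesis using one_minus_power_nonzero[of q N] q False by simp
qed

lemma bailey_step_theta:
  assumes q: "norm q < 1" "q \<noteq> 0"
    and B: "\<And>s. bailey_sum q (theta_term x Q) s = B s"
    and "x * q = x'" "Q * q ^ 2 = Q'"
  shows "bailey_sum q (theta_term x' Q') N = (\<Sum>s\<le>N. q ^ s\<^sup>2 * inv_qfact q (int N - int s) * B s)"
  using bailey_step[OF q(1), of N "theta_term x Q"] assms
  by (simp add: theta_term_shift)

text \<open>
  The links of the chain. Starting from \<open>(x, Q) = (q, q)\<close>, a step gives \<open>(q\<^sup>2, q\<^sup>3)\<close>, from where either a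
  further step or a lift is possible; the names below record the pair reached.
\<close>
context
  fixes q :: complex
  assumes q: "norm q < 1" "q \<noteq> 0"
begin

lemma bailey_q2_3: "bailey_sum q (theta_term (q ^ 2) (q ^ 3)) N = inv_qfact q (int N)"
proof -
  have "bailey_sum q (theta_term (q ^ 2) (q ^ 3)) N
    = (\<Sum>s\<le>N. q ^ s\<^sup>2 * inv_qfact q (int N - int s) * (if s = 0 then 1 else 0))"
    by (rule bailey_step_theta[OF q bailey_sum_theta_base[OF q]]) (auto simp: power2_eq_square power3_eq_cube)
  also have "\<dots> = inv_qfact q (int N)"
    by (subst sum.remove[of _ 0]) auto
  finally show ?thesis .
qed

lemma bailey_q3_3: "bailey_sum q (theta_term (q ^ 3) (q ^ 3)) N = q ^ N * inv_qfact q (int N)"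
proof -
  have "q ^ 3 / q = q ^ 2" using q(2) by (simp add: power2_eq_square power3_eq_cube)
  thus ?thesis using bailey_lift[of q "q ^ 3" N] bailey_q2_3[of N] q by simp
qed

lemma bailey_q3_5:
  "bailey_sum q (theta_term (q ^ 3) (q ^ 5)) N
     = (\<Sum>s\<le>N. q ^ s\<^sup>2 * inv_qfact q (int N - int s) * inv_qfact q (int s))"
  by (rule bailey_step_theta[OF q bailey_q2_3]) (simp_all flip: power_Suc2 power_add)

lemma bailey_q4_5:
  "bailey_sum q (theta_term (q ^ 4) (q ^ 5)) N
     = (\<Sum>s\<le>N. q ^ s\<^sup>2 * inv_qfact q (int N - int s) * (q ^ s * inv_qfact q (int s)))"
  by (rule bailey_step_theta[OF q bailey_q3_3]) (simp_all flip: power_Suc2 power_add)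

lemma bailey_q5_5:
  "bailey_sum q (theta_term (q ^ 5) (q ^ 5)) N
     = q ^ N * (\<Sum>s\<le>N. q ^ s\<^sup>2 * inv_qfact q (int N - int s) * (q ^ s * inv_qfact q (int s)))"
proof -
  have "q ^ 5 / q = q ^ 4" using q(2) by (simp add: eval_nat_numeral)
  thus ?thesis using bailey_lift[of q "q ^ 5" N] bailey_q4_5[of N] q by simp
qed

end

section \<open>Limits\<close>

text \<open>
  Dominated convergence for series over an arbitrary index set: the bound makes the finite partial sums
  converge uniformly in \<open>n\<close>, so that the two limits may be exchanged.
\<close>
lemma tannery_infsum:
  fixes f :: "nat \<Rightarrow> 'a \<Rightarrow> complex"
  assumes lim: "\<And>k. (\<lambda>n. f n k) \<longlonglongrightarrow> g k"
    and bound: "\<And>n k. norm (f n k) \<le> M k" and M: "M summable_on UNIV"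
  shows "(\<lambda>n. infsum (f n) UNIV) \<longlonglongrightarrow> infsum g UNIV"
proof (rule swap_uniform_limit')
  have "norm (g k) \<le> M k" for k
    using bound by (intro LIMSEQ_le_const2[OF tendsto_norm[OF lim]]) auto
  hence "(\<lambda>k. norm (g k)) summable_on UNIV"
    by (intro Infinite_Sum.abs_summable_on_comparison_test'[where g = M] M)
  hence "g summable_on UNIV" by (rule abs_summable_summable)
  thus "(sum g \<longlongrightarrow> infsum g UNIV) (finite_subsets_at_top UNIV)" by (rule infsum_tendsto)
  show "uniform_limit UNIV (\<lambda>X n. \<Sum>k\<in>X. f n k) (\<lambda>n. infsum (f n) UNIV) (finite_subsets_at_top UNIV)"
    using bound M by (intro Weierstrass_m_test_general) auto
  show "\<forall>\<^sub>F X in finite_subsets_at_top UNIV. (\<lambda>n. \<Sum>k\<in>X. f n k) \<longlonglongrightarrow> sum g X"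
    by (intro always_eventually allI tendsto_sum lim)
qed auto

lemma qpoch_tendsto:
  assumes "norm q < 1"
  shows "qpoch a q \<longlonglongrightarrow> qpoch_inf a q"
proof -
  have "(\<lambda>n. \<Prod>m\<le>n. 1 - a * q ^ m) \<longlonglongrightarrow> qpoch_inf a q"
    unfolding qpoch_inf_def by (intro convergent_prod_LIMSEQ convergent_prod_qpoch assms)
  hence "(\<lambda>n. qpoch a q (Suc n)) \<longlonglongrightarrow> qpoch_inf a q"
    by (simp add: qpoch_def lessThan_Suc_atMost)
  thus ?thesis by (rule LIMSEQ_imp_Suc)
qed

lemma qpoch_inf_self_nonzero:
  assumes "norm q < 1"
  shows "qpoch_inf q q \<noteq> 0"
  unfolding qpoch_inf_def
  using one_minus_power_nonzero[OF assms, of "Suc m" for m]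
  by (intro prodinf_nonzero convergent_prod_qpoch assms) auto

lemma inv_qfact_tendsto:
  assumes "norm q < 1"
  shows "(\<lambda>n. inv_qfact q (int n)) \<longlonglongrightarrow> 1 / qpoch_inf q q"
  unfolding inv_qfact_nat
  by (intro tendsto_intros qpoch_tendsto qpoch_inf_self_nonzero assms)

lemma inv_qfact_tendsto_int:
  assumes "norm q < 1"
  shows "(\<lambda>n. inv_qfact q (int n + m)) \<longlonglongrightarrow> 1 / qpoch_inf q q"
proof (rule Lim_transform_eventually)
  have "filterlim (\<lambda>n. nat (int n + m)) sequentially sequentially"
  proof (rule filterlim_at_top_mono)
    show "filterlim (\<lambda>n. n - nat (- m)) at_top at_top" by (rule filterlim_minus_const_nat_at_top)
  qed (auto intro!: always_eventually)
  with inv_qfact_tendsto[OF assms]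
  show "(\<lambda>n. inv_qfact q (int (nat (int n + m)))) \<longlonglongrightarrow> 1 / qpoch_inf q q"
    by (rule filterlim_compose)
  show "\<forall>\<^sub>F n in sequentially. inv_qfact q (int (nat (int n + m))) = inv_qfact q (int n + m)"
    using eventually_ge_at_top[of "nat (- m)"] by eventually_elim simp
qed

text \<open>
  The majorants needed for the exchange of limits come from this bound: every Bailey sum is dominated
  termwise by a multiple of \<open>A\<close>.
\<close>
lemma inv_qfact_bounded:
  assumes "norm q < 1"
  obtains C where "C > 0" "\<And>n. norm (inv_qfact q n) \<le> C"
proof -
  have "Bseq (\<lambda>n. inv_qfact q (int n))"
    using inv_qfact_tendsto[OF assms] by (intro convergent_imp_Bseq) (auto simp: convergent_def)
  then obtain C where C: "C > 0" "\<And>n. norm (inv_qfact q (int n)) \<le> C"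
    by (auto elim!: BseqE)
  have "norm (inv_qfact q n) \<le> C" for n
    using C(2)[of "nat n"] C(1) by (cases "n < 0") auto
  with C(1) show ?thesis using that by blast
qed

lemma bailey_sum_tendsto:
  assumes q: "norm q < 1" and A: "(\<lambda>m. norm (A m)) summable_on UNIV"
  shows "bailey_sum q A \<longlonglongrightarrow> infsum A UNIV / (qpoch_inf q q)\<^sup>2"
proof -
  obtain C where C: "C > 0" "\<And>n. norm (inv_qfact q n) \<le> C"
    using inv_qfact_bounded[OF q] by blast
  define f where "f = (\<lambda>N m. A m * inv_qfact q (int N - m) * inv_qfact q (int N + m))"
  have "(\<lambda>N. infsum (f N) UNIV) \<longlonglongrightarrow> infsum (\<lambda>m. A m * (1 / qpoch_inf q q) * (1 / qpoch_inf q q)) UNIV"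
  proof (rule tannery_infsum)
    show "(\<lambda>N. f N m) \<longlonglongrightarrow> A m * (1 / qpoch_inf q q) * (1 / qpoch_inf q q)" for m
      unfolding f_def using inv_qfact_tendsto_int[OF q, of m] inv_qfact_tendsto_int[OF q, of "- m"]
      by (intro tendsto_intros) auto
    show "norm (f N m) \<le> norm (A m) * (C * C)" for N m
      unfolding f_def norm_mult mult.assoc using C
      by (intro mult_left_mono mult_mono) (auto intro: less_imp_le)
    show "(\<lambda>m. norm (A m) * (C * C)) summable_on UNIV"
      by (intro summable_on_cmult_left A)
  qed
  moreover have "infsum (f N) UNIV = bailey_sum q A N" for N
  proof -
    have "infsum (f N) UNIV = infsum (f N) {- int N..int N}"
      by (rule infsum_cong_neutral) (auto simp: f_def not_le)
    thus ?thesis by (simp add: bailey_sum_def f_def)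
  qed
  moreover have "infsum (\<lambda>m. A m * (1 / qpoch_inf q q) * (1 / qpoch_inf q q)) UNIV
      = infsum A UNIV / (qpoch_inf q q)\<^sup>2"
    unfolding mult.assoc by (subst infsum_cmult_left') (simp add: power2_eq_square)
  ultimately show ?thesis by (simp add: tendsto_cong)
qed

section \<open>The Jacobi triple product\<close>

lemma half_mult_pred: "(m + 1) * (m + 1 - 1) div 2 = m + m * (m - 1) div 2" for m :: int
  using even_mult_pred[of m] even_mult_pred[of "m + 1"] by (simp add: algebra_simps)

lemma theta_term_Suc:
  assumes "x \<noteq> 0" "Q \<noteq> 0"
  shows "theta_term x Q (m + 1) = - x * Q powi m * theta_term x Q m"
  unfolding theta_term_def half_mult_pred using assms by (simp add: power_int_add)

lemma theta_term_nat_summable: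
  assumes "norm Q < 1" "x \<noteq> 0" "Q \<noteq> 0"
  shows "summable (\<lambda>n. norm (theta_term x Q (int n)))"
proof -
  have "(\<lambda>n. norm x * norm Q ^ n) \<longlonglongrightarrow> norm x * 0"
    using assms by (intro tendsto_intros LIMSEQ_power_zero) auto
  hence "\<forall>\<^sub>F n in sequentially. norm x * norm Q ^ n < 1 / 2"
    by (rule order_tendstoD) simp
  then obtain N where N: "\<And>n. n \<ge> N \<Longrightarrow> norm x * norm Q ^ n < 1 / 2"
    by (auto simp: eventually_at_top_linorder)
  show ?thesis
  proof (rule summable_ratio_test[of "1 / 2" N])
    fix n assume "n \<ge> N"
    have "theta_term x Q (int (Suc n)) = - x * Q ^ n * theta_term x Q (int n)"
      using theta_term_Suc[OF assms(2,3), of "int n"] by (simp add: add.commute)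
    hence "norm (theta_term x Q (int (Suc n))) = (norm x * norm Q ^ n) * norm (theta_term x Q (int n))"
      by (simp add: norm_mult norm_power)
    also have "\<dots> \<le> 1 / 2 * norm (theta_term x Q (int n))"
      using N[OF \<open>n \<ge> N\<close>] by (intro mult_right_mono) auto
    finally show "norm (norm (theta_term x Q (int (Suc n)))) \<le> 1 / 2 * norm (norm (theta_term x Q (int n)))"
      by simp
  qed simp
qed

text \<open>
  The half of the series with negative indices is, by \<open>theta_term_uminus\<close>, the positive half for \<open>Q / x\<close>,
  to which the ratio test applies as well.
\<close>
lemma theta_term_abs_summable:
  assumes "norm Q < 1" "x \<noteq> 0" "Q \<noteq> 0"
  shows "(\<lambda>m. norm (theta_term x Q m)) summable_on UNIV"
proof -
  have nat: "(\<lambda>n. norm (theta_term y Q (int n))) summable_on UNIV" if "y \<noteq> 0" for y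
    using theta_term_nat_summable[OF assms(1) that assms(3)]
    by (intro norm_summable_imp_summable_on) simp
  have "(\<lambda>m. norm (theta_term x Q m)) summable_on range int"
    using nat[OF assms(2)] by (subst summable_on_reindex) (auto simp: o_def)
  moreover have "(\<lambda>m. norm (theta_term x Q m)) summable_on range (\<lambda>n. - int n)"
    using nat[of "Q / x"] assms
    by (subst summable_on_reindex) (auto simp: o_def theta_term_uminus inj_on_def)
  moreover have "(UNIV :: int set) = range int \<union> range (\<lambda>n. - int n)"
    by (auto simp: image_iff) (metis int_cases2)
  ultimately show ?thesis by (metis summable_on_union)
qed

text \<open>
  Expanding \<open>(1 - x Q\<^sup>N) (1 - Q\<^bsup>N + 1\<^esup> / x)\<close> and shifting \<open>m\<close> by \<open>\<plusminus>1\<close> in the two terms that are linear in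
  \<open>x\<close> and \<open>1 / x\<close> makes both sides sums of multiples of the same theta term. With
  \<open>A = Q\<^bsup>N + 1 - m\<^esup>\<close> and \<open>B = Q\<^bsup>N + 1 + m\<^esup>\<close> the coefficients agree because of the polynomial identity
  \<open>(1 - AB/Q) (1 - AB) = (1 + AB/Q) (1 - A) (1 - B) + A (1 - B) (1 - B/Q) + B (1 - A) (1 - A/Q)\<close>.
\<close>
lemma finite_triple_product_step:
  assumes Q: "norm Q < 1" "Q \<noteq> 0" "x \<noteq> 0"
  shows "(1 - Q ^ (2 * N + 1)) * (1 - Q ^ (2 * N + 2)) * bailey_sum Q (theta_term x Q) (Suc N)
       = (1 - x * Q ^ N) * (1 - Q / x * Q ^ N) * bailey_sum Q (theta_term x Q) N"
proof -
  define r where "r = inv_qfact Q"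
  define n where "n = int N"
  define h where "h = (\<lambda>m. theta_term x Q m * r (n - m) * r (n + m))"
  define R where "R = {- (n + 1)..n + 1}"
  have H: "bailey_sum Q (theta_term x Q) N = sum h R"
    using bailey_sum_extend[of N "Suc N" Q "theta_term x Q"]
    by (simp add: h_def r_def R_def n_def add_ac)
  have shift: "sum h R = (\<Sum>m\<in>R. h (m + d))" if d: "d = 1 \<or> d = -1" for d
  proof -
    have "sum h {- n - 2..n + 2} = (\<Sum>m\<in>{- n - 2 - d..n + 2 - d}. h (m + d))"
      by (rule sum.reindex_bij_witness[of _ "\<lambda>m. m + d" "\<lambda>m. m - d"]) auto
    also have "\<dots> = (\<Sum>m\<in>R. h (m + d))"
      using d by (intro sum.mono_neutral_right) (auto simp: R_def h_def r_def)
    also have "sum h {- n - 2..n + 2} = sum h R"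
      by (intro sum.mono_neutral_right) (auto simp: R_def h_def r_def)
    finally show ?thesis .
  qed
  have key: "(1 - Q ^ (2 * N + 1)) * (1 - Q ^ (2 * N + 2)) * (theta_term x Q m * r (n + 1 - m) * r (n + 1 + m))
      = (1 + Q ^ (2 * N + 1)) * h m - x * Q ^ N * h (m + - 1) - Q ^ Suc N / x * h (m + 1)" for m
  proof -
    define \<theta> a b A B where "\<theta> = theta_term x Q m" and "a = r (n + 1 - m)" and "b = r (n + 1 + m)"
      and "A = Q powi (n + 1 - m)" and "B = Q powi (n + 1 + m)"
    have rec: "r (k - 1) = (1 - Q powi k) * r k" for k
      using inv_qfact_rec[OF Q(1), of k] by (simp add: r_def)
    have pow: "Q powi (k - 1) = Q powi k / Q" for k
      using Q(2) by (simp add: power_int_diff)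
    have 1: "r (n - m) = (1 - A) * a" using rec[of "n + 1 - m"] by (simp add: A_def a_def)
    have 2: "r (n + m) = (1 - B) * b" using rec[of "n + 1 + m"] by (simp add: B_def b_def)
    have 3: "r (n - (m + 1)) = (1 - A / Q) * ((1 - A) * a)"
      using rec[of "n - m"] pow[of "n + 1 - m"] 1 by (simp add: A_def diff_diff_eq)
    have 4: "r (n + (m + - 1)) = (1 - B / Q) * ((1 - B) * b)"
      using rec[of "n + m"] pow[of "n + 1 + m"] 2 by (simp add: B_def add_diff_eq)
    have AB: "A * B = Q ^ (2 * N + 2)"
    proof -
      have "A * B = Q powi ((n + 1 - m) + (n + 1 + m))"
        unfolding A_def B_def using Q(2) by (subst power_int_add) auto
      also have "(n + 1 - m) + (n + 1 + m) = int (2 * N + 2)" by (simp add: n_def)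
      finally show ?thesis by (simp only: power_int_of_nat)
    qed
    hence AB': "Q ^ (2 * N + 1) = A * B / Q" using Q(2) by simp
    have up: "Q ^ Suc N / x * theta_term x Q (m + 1) = - B * \<theta>"
    proof -
      have "Q ^ Suc N * Q powi m = B"
        using Q(2) unfolding B_def by (simp add: n_def power_int_add mult_ac)
      thus ?thesis unfolding theta_term_Suc[OF Q(3,2)] using Q(3) by (auto simp: \<theta>_def)
    qed
    have dn: "x * Q ^ N * theta_term x Q (m + - 1) = - A * \<theta>"
    proof -
      have *: "A * Q powi (m - 1) = Q ^ N"
      proof -
        have "A * Q powi (m - 1) = Q powi ((n + 1 - m) + (m - 1))"
          unfolding A_def using Q(2) by (subst power_int_add) auto
        thus ?thesis by (simp add: n_def)
      qed
      have "\<theta> = - x * Q powi (m - 1) * theta_term x Q (m - 1)"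
        using theta_term_Suc[OF Q(3,2), of "m - 1"] by (simp add: \<theta>_def)
      hence "- A * \<theta> = x * (A * Q powi (m - 1)) * theta_term x Q (m - 1)" by simp
      thus ?thesis unfolding * by simp
    qed
    have dn': "x * Q ^ N * h (m + - 1) = - A * \<theta> * a * ((1 - B / Q) * ((1 - B) * b))"
    proof -
      have "n - (m + - 1) = n + 1 - m" by simp
      hence "h (m + - 1) = theta_term x Q (m + - 1) * a * ((1 - B / Q) * ((1 - B) * b))"
        by (simp only: h_def 4 a_def)
      thus ?thesis unfolding dn[symmetric] by (simp only: mult.assoc)
    qed
    have up': "Q ^ Suc N / x * h (m + 1) = - B * \<theta> * ((1 - A / Q) * ((1 - A) * a)) * b"
    proof -
      have "n + (m + 1) = n + 1 + m" by simp
      hence "h (m + 1) = theta_term x Q (m + 1) * ((1 - A / Q) * ((1 - A) * a)) * b"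
        by (simp only: h_def 3 b_def)
      thus ?thesis unfolding up[symmetric] by (simp only: mult.assoc)
    qed
    have mid: "h m = \<theta> * ((1 - A) * a) * ((1 - B) * b)"
      unfolding h_def 1 2 \<theta>_def ..
    show ?thesis
      unfolding up' dn' mid AB[symmetric] AB' \<theta>_def[symmetric] a_def[symmetric] b_def[symmetric]
      using Q(2) by (simp add: field_simps)
  qed
  have "(1 - Q ^ (2 * N + 1)) * (1 - Q ^ (2 * N + 2)) * bailey_sum Q (theta_term x Q) (Suc N)
     = (\<Sum>m\<in>R. (1 - Q ^ (2 * N + 1)) * (1 - Q ^ (2 * N + 2)) * (theta_term x Q m * r (n + 1 - m) * r (n + 1 + m)))"
    unfolding bailey_sum_def sum_distrib_left by (simp add: R_def r_def n_def add_ac)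
  also have "\<dots> = (1 + Q ^ (2 * N + 1)) * sum h R - x * Q ^ N * (\<Sum>m\<in>R. h (m + - 1)) - Q ^ Suc N / x * (\<Sum>m\<in>R. h (m + 1))"
    unfolding key sum_subtractf sum_distrib_left ..
  also have "\<dots> = ((1 + Q ^ (2 * N + 1)) - x * Q ^ N - Q ^ Suc N / x) * sum h R"
    using shift[of 1] shift[of "-1"] by (simp add: algebra_simps)
  also have "(1 + Q ^ (2 * N + 1)) - x * Q ^ N - Q ^ Suc N / x = (1 - x * Q ^ N) * (1 - Q / x * Q ^ N)"
    using Q(3) by (simp add: field_simps mult_2_right power_add)
  finally show ?thesis unfolding H .
qed

lemma finite_triple_product:
  assumes Q: "norm Q < 1" "Q \<noteq> 0" "x \<noteq> 0"
  shows "bailey_sum Q (theta_term x Q) N = qpoch x Q N * qpoch (Q / x) Q N * inv_qfact Q (int (2 * N))"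
proof (induction N)
  case 0
  show ?case by (simp add: bailey_sum_def theta_term_def qpoch_def)
next
  case (Suc N)
  define c where "c = (1 - Q ^ (2 * N + 1)) * (1 - Q ^ (2 * N + 2))"
  have c: "c \<noteq> 0"
    unfolding c_def mult_eq_0_iff using one_minus_power_nonzero[OF Q(1)] by (metis add_gr_0 zero_less_numeral zero_less_one)
  have "c * inv_qfact Q (int (2 * Suc N)) = inv_qfact Q (int (2 * N))"
    using inv_qfact_rec_nat[OF Q(1), of "2 * N"] inv_qfact_rec_nat[OF Q(1), of "2 * N + 1"]
    unfolding c_def by (simp del: power_Suc add: mult.assoc)
  hence rec: "inv_qfact Q (int (2 * N)) = c * inv_qfact Q (int (2 * Suc N))" by (rule sym)
  have "c * bailey_sum Q (theta_term x Q) (Suc N) = (1 - x * Q ^ N) * (1 - Q / x * Q ^ N) *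
      (qpoch x Q N * qpoch (Q / x) Q N * inv_qfact Q (int (2 * N)))"
    using finite_triple_product_step[OF Q, of N] Suc by (simp only: c_def)
  also have "\<dots> = c * (qpoch x Q (Suc N) * qpoch (Q / x) Q (Suc N) * inv_qfact Q (int (2 * Suc N)))"
    unfolding rec qpoch_def prod.lessThan_Suc by (simp only: mult_ac)
  finally have "c * bailey_sum Q (theta_term x Q) (Suc N) =
    c * (qpoch x Q (Suc N) * qpoch (Q / x) Q (Suc N) * inv_qfact Q (int (2 * Suc N)))" .
  thus ?case using c by simp
qed

text \<open>
  Let \<open>N\<close> tend to infinity in \<open>finite_triple_product\<close>. The Bailey sum tends to the theta series divided by
  \<open>(Q; Q)\<^sub>\<infinity>\<^sup>2\<close>, and the last factor on the right to \<open>1 / (Q; Q)\<^sub>\<infinity>\<close>, which leaves one factor \<open>(Q; Q)\<^sub>\<infinity>\<close>.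
\<close>
lemma jacobi_triple_product:
  assumes Q: "norm Q < 1" "Q \<noteq> 0" "x \<noteq> 0"
  shows "(\<Sum>\<^sub>\<infinity>m. theta_term x Q m) = qpoch_inf x Q * qpoch_inf (Q / x) Q * qpoch_inf Q Q"
proof -
  define P where "P = qpoch_inf Q Q"
  have P: "P \<noteq> 0" using qpoch_inf_self_nonzero[OF Q(1)] by (simp add: P_def)
  have "bailey_sum Q (theta_term x Q) \<longlonglongrightarrow> (\<Sum>\<^sub>\<infinity>m. theta_term x Q m) / P\<^sup>2"
    unfolding P_def by (intro bailey_sum_tendsto theta_term_abs_summable Q)
  moreover have "bailey_sum Q (theta_term x Q) \<longlonglongrightarrow> qpoch_inf x Q * qpoch_inf (Q / x) Q * (1 / P)"
  proof -
    have "(\<lambda>N. inv_qfact Q (int (2 * N))) \<longlonglongrightarrow> 1 / P"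
      unfolding P_def
      by (rule filterlim_compose[OF inv_qfact_tendsto[OF Q(1)]]) (simp add: filterlim_subseq strict_mono_def)
    thus ?thesis unfolding finite_triple_product[OF Q, abs_def]
      by (intro tendsto_intros qpoch_tendsto Q)
  qed
  ultimately have "(\<Sum>\<^sub>\<infinity>m. theta_term x Q m) / P\<^sup>2 = qpoch_inf x Q * qpoch_inf (Q / x) Q * (1 / P)"
    by (rule LIMSEQ_unique)
  thus ?thesis using P by (simp add: P_def[symmetric] field_simps power2_eq_square)
qed

section \<open>The Bailey step in the limit\<close>

text \<open>
  Let \<open>N\<close> tend to infinity in \<open>bailey_step\<close>. On the left \<open>1 / (q; q)\<^bsub>N - s\<^esub>\<close> contributes one factor
  \<open>1 / (q; q)\<^sub>\<infinity>\<close>, on the right there are two of them; one cancels. The Bailey sums are bounded since they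
  converge, which supplies a geometric majorant on the left.
\<close>
lemma bailey_limit:
  assumes q: "norm q < 1"
    and A: "(\<lambda>m. norm (A m)) summable_on UNIV"
    and A': "(\<lambda>m. norm (q powi (m\<^sup>2) * A m)) summable_on UNIV"
  shows "(\<Sum>\<^sub>\<infinity>s. q ^ s\<^sup>2 * bailey_sum q A s) = (\<Sum>\<^sub>\<infinity>m. q powi (m\<^sup>2) * A m) / qpoch_inf q q"
proof -
  define P where "P = qpoch_inf q q"
  have P: "P \<noteq> 0" using qpoch_inf_self_nonzero[OF q] by (simp add: P_def)
  have "Bseq (bailey_sum q A)"
    using bailey_sum_tendsto[OF q A] by (intro convergent_imp_Bseq) (auto simp: convergent_def)
  then obtain D where D: "D > 0" "\<And>s. norm (bailey_sum q A s) \<le> D" by (auto elim!: BseqE)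
  obtain C where C: "C > 0" "\<And>n. norm (inv_qfact q n) \<le> C"
    using inv_qfact_bounded[OF q] by blast
  define f where "f = (\<lambda>N s. q ^ s\<^sup>2 * inv_qfact q (int N - int s) * bailey_sum q A s)"
  have "(\<lambda>N. infsum (f N) UNIV) \<longlonglongrightarrow> (\<Sum>\<^sub>\<infinity>s. q ^ s\<^sup>2 * (1 / P) * bailey_sum q A s)"
  proof (rule tannery_infsum)
    show "(\<lambda>N. f N s) \<longlonglongrightarrow> q ^ s\<^sup>2 * (1 / P) * bailey_sum q A s" for s
      unfolding f_def P_def using inv_qfact_tendsto_int[OF q, of "- int s"]
      by (intro tendsto_intros) auto
    show "norm (f N s) \<le> norm q ^ s * C * D" for N s
    proof -
      have "norm q ^ s\<^sup>2 \<le> norm q ^ s"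
        using q by (intro power_decreasing) (auto simp: power2_eq_square)
      thus ?thesis unfolding f_def norm_mult norm_power using C D q
        by (intro mult_mono) auto
    qed
    show "(\<lambda>s. norm q ^ s * C * D) summable_on UNIV"
      using q by (intro summable_on_cmult_left norm_summable_imp_summable_on) (auto intro!: summable_geometric)
  qed
  moreover have "infsum (f N) UNIV = bailey_sum q (\<lambda>m. q powi (m\<^sup>2) * A m) N" for N
  proof -
    have "infsum (f N) UNIV = infsum (f N) {..N}"
      by (rule infsum_cong_neutral) (auto simp: f_def)
    thus ?thesis using bailey_step[OF q, of N A] by (simp add: f_def)
  qed
  ultimately have "bailey_sum q (\<lambda>m. q powi (m\<^sup>2) * A m) \<longlonglongrightarrow> (\<Sum>\<^sub>\<infinity>s. q ^ s\<^sup>2 * (1 / P) * bailey_sum q A s)"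
    by simp
  moreover have "bailey_sum q (\<lambda>m. q powi (m\<^sup>2) * A m) \<longlonglongrightarrow> (\<Sum>\<^sub>\<infinity>m. q powi (m\<^sup>2) * A m) / P\<^sup>2"
    unfolding P_def by (intro bailey_sum_tendsto q A')
  ultimately have "(\<Sum>\<^sub>\<infinity>s. q ^ s\<^sup>2 * (1 / P) * bailey_sum q A s) = (\<Sum>\<^sub>\<infinity>m. q powi (m\<^sup>2) * A m) / P\<^sup>2"
    by (rule LIMSEQ_unique)
  moreover have "(\<Sum>\<^sub>\<infinity>s. q ^ s\<^sup>2 * (1 / P) * bailey_sum q A s) = (1 / P) * (\<Sum>\<^sub>\<infinity>s. q ^ s\<^sup>2 * bailey_sum q A s)"
    by (subst infsum_cmult_right'[symmetric]) (simp add: mult_ac)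
  ultimately show ?thesis using P by (simp add: P_def[symmetric] field_simps power2_eq_square)
qed

text \<open>
  For theta sequences the limit can be evaluated by the triple product. The quotient \<open>Q' / x'\<close> enters
  through a parameter \<open>y\<close> so that for monomials \<open>x\<close> and \<open>Q\<close> in \<open>q\<close> the result contains only powers of \<open>q\<close>.
\<close>
lemma bailey_limit_theta:
  assumes q: "norm q < 1" "q \<noteq> 0" "x \<noteq> 0" and Q: "norm Q < 1" "Q \<noteq> 0"
    and x': "x' = x * q" and Q': "Q' = Q * q ^ 2" and y: "x' * y = Q'"
  shows "(\<Sum>\<^sub>\<infinity>s. q ^ s\<^sup>2 * bailey_sum q (theta_term x Q) s)
      = qpoch_inf y Q' * qpoch_inf x' Q' * qpoch_inf Q' Q' / qpoch_inf q q"
proof -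
  have "norm (q ^ 2) \<le> 1" using q by (simp add: norm_power power_le_one)
  hence "norm Q' < 1"
    unfolding Q' norm_mult using Q(1) by (metis mult_left_le norm_ge_zero order_le_less_trans)
  have nz: "x' \<noteq> 0" "Q' \<noteq> 0" using q Q x' Q' by auto
  have y': "Q' / x' = y" using y nz by (simp add: field_simps)
  have shift: "q powi (m\<^sup>2) * theta_term x Q m = theta_term x' Q' m" for m
    unfolding x' Q' by (rule theta_term_shift[OF q(2)])
  have "(\<Sum>\<^sub>\<infinity>s. q ^ s\<^sup>2 * bailey_sum q (theta_term x Q) s) = (\<Sum>\<^sub>\<infinity>m. theta_term x' Q' m) / qpoch_inf q q"
    using bailey_limit[OF q(1), of "theta_term x Q"] theta_term_abs_summable[OF \<open>norm Q' < 1\<close> nz]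
      theta_term_abs_summable[OF Q(1) q(3) Q(2)] by (simp add: shift)
  also have "(\<Sum>\<^sub>\<infinity>m. theta_term x' Q' m) = qpoch_inf y Q' * qpoch_inf x' Q' * qpoch_inf Q' Q'"
    by (subst jacobi_triple_product) (use nz \<open>norm Q' < 1\<close> y' in auto)
  finally show ?thesis .
qed

section \<open>Reduction of the triple sums\<close>

text \<open>
  The coefficient of \<open>x\<^sup>s\<close> in \<open>(-x; q)\<^sub>\<infinity> / (x\<^sup>2; q\<^sup>2)\<^sub>\<infinity> = 1 / (x; q)\<^sub>\<infinity>\<close>. Let \<open>u\<^sub>s\<close> denote the sum and
  \<open>i = s - 2 k\<close>. The functional equation behind it is \<open>(1 - q\<^sup>s) u\<^sub>s = u\<^bsub>s - 1\<^esub>\<close>; it follows from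
  \<open>1 - q\<^bsup>i + 2 k\<^esup> = (1 - q\<^sup>i) + q\<^sup>i (1 - q\<^bsup>2 k\<^esup>)\<close>, where the second part lowers \<open>k\<close> by one and is
  reabsorbed after a shift of \<open>k\<close>. Any bound \<open>K \<ge> s / 2\<close> gives the full sum, and keeping \<open>K\<close> fixed lets the
  induction compare sums over the same range.
\<close>
lemma inv_qfact_convolution_int:
  fixes q :: complex
  assumes q: "norm q < 1" "q \<noteq> 0" and "s \<le> 2 * K"
  defines "t \<equiv> (\<lambda>(s::int) k. q powi ((s - 2 * int k) * (s - 2 * int k - 1) div 2) * inv_qfact q (s - 2 * int k) * inv_qfact (q ^ 2) (int k))"
  shows "(\<Sum>k\<le>K. t (int s) k) = inv_qfact q (int s)"
  using \<open>s \<le> 2 * K\<close>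
proof (induction s)
  case 0
  have "(\<Sum>k\<le>K. t (int 0) k) = (\<Sum>k\<in>{0}. t (int 0) k)"
    by (rule sum.mono_neutral_right) (auto simp: t_def)
  thus ?case by (simp add: t_def)
next
  case (Suc s)
  have q2: "norm (q ^ 2) < 1" using q by (simp add: norm_power power_less_one_iff)
  define e where "e = (\<lambda>i::int. i * (i - 1) div 2)"
  have e: "e i = e (i - 1) + (i - 1)" for i
    using half_mult_pred[of "i - 1"] by (simp add: e_def)
  define S where "S = int (Suc s)"
  \<comment> \<open>\<open>d + d'\<close> is the splitting of \<open>(1 - q\<^sup>s) t\<close>; \<open>c\<close> is \<open>d'\<close> shifted by one, and \<open>d + c\<close> is the term for \<open>s - 1\<close>\<close>
  define c where "c = (\<lambda>k. q powi e (S - 1 - 2 * int k) * inv_qfact q (S - 2 - 2 * int k) * inv_qfact (q ^ 2) (int k))"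
  define d where "d = (\<lambda>k. q powi e (S - 2 * int k) * inv_qfact q (S - 1 - 2 * int k) * inv_qfact (q ^ 2) (int k))"
  define d' where "d' = (\<lambda>k. q powi e (S + 1 - 2 * int k) * inv_qfact q (S - 2 * int k) * inv_qfact (q ^ 2) (int k - 1))"
  have t: "t s k = q powi e (s - 2 * int k) * inv_qfact q (s - 2 * int k) * inv_qfact (q ^ 2) (int k)" for s k
    by (simp only: t_def e_def)
  have split: "(1 - q ^ Suc s) * t S k = d k + d' k" for k
  proof -
    have "q ^ Suc s = q powi (S - 2 * int k + 2 * int k)" by (simp add: S_def del: power_Suc of_nat_Suc)
    also have "\<dots> = q powi (S - 2 * int k) * q powi (2 * int k)"
      using q by (subst power_int_add) auto
    also have "q powi (2 * int k) = (q ^ 2) powi int k" by (simp only: power_int_mult power_int_numeral)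
    finally have 1: "q ^ Suc s = q powi (S - 2 * int k) * (q ^ 2) powi int k" .
    have 2: "inv_qfact q (S - 1 - 2 * int k) = (1 - q powi (S - 2 * int k)) * inv_qfact q (S - 2 * int k)"
      using inv_qfact_rec[OF q(1), of "S - 2 * int k"] by (simp add: algebra_simps)
    have 3: "inv_qfact (q ^ 2) (int k - 1) = (1 - (q ^ 2) powi int k) * inv_qfact (q ^ 2) (int k)"
      using inv_qfact_rec[OF q2, of "int k"] by simp
    have 4: "q powi e (S + 1 - 2 * int k) = q powi e (S - 2 * int k) * q powi (S - 2 * int k)"
    proof -
      have "e (S + 1 - 2 * int k) = e (S - 2 * int k) + (S - 2 * int k)"
        using e[of "S + 1 - 2 * int k"] by (simp add: algebra_simps)
      thus ?thesis using q by (simp only: power_int_add simp_thms)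
    qed
    show ?thesis
      unfolding d_def d'_def t 1 2 3 4 by (simp add: algebra_simps)
  qed
  have merge: "d k + c k = t (S - 1) k" for k
  proof -
    have 1: "inv_qfact q (S - 2 - 2 * int k) = (1 - q powi (S - 1 - 2 * int k)) * inv_qfact q (S - 1 - 2 * int k)"
      using inv_qfact_rec[OF q(1), of "S - 1 - 2 * int k"] by (simp add: algebra_simps)
    have 2: "q powi e (S - 2 * int k) = q powi e (S - 1 - 2 * int k) * q powi (S - 1 - 2 * int k)"
    proof -
      have "e (S - 2 * int k) = e (S - 1 - 2 * int k) + (S - 1 - 2 * int k)"
        using e[of "S - 2 * int k"] by (simp add: algebra_simps)
      thus ?thesis using q by (simp only: power_int_add simp_thms)
    qed
    show ?thesis
      unfolding d_def c_def t 1 2 by (simp add: algebra_simps)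
  qed
  have "sum d' {..K} = sum c {..K}"
  proof -
    have "sum d' {..K} = sum d' {..Suc K}"
      using Suc.prems by (simp add: d'_def S_def)
    also have "\<dots> = d' 0 + (\<Sum>k\<le>K. d' (Suc k))" by (rule sum.atMost_Suc_shift)
    also have "d' 0 = 0" by (simp add: d'_def)
    also have "(\<Sum>k\<le>K. d' (Suc k)) = sum c {..K}"
      by (intro sum.cong refl) (simp add: c_def d'_def algebra_simps)
    finally show ?thesis by simp
  qed
  hence "(1 - q ^ Suc s) * (\<Sum>k\<le>K. t S k) = (\<Sum>k\<le>K. d k + c k)"
    unfolding sum_distrib_left split by (simp add: sum.distrib)
  also have "\<dots> = inv_qfact q (int s)"
    unfolding merge using Suc by (simp add: S_def)
  also have "\<dots> = (1 - q ^ Suc s) * inv_qfact q (int (Suc s))"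
    by (rule inv_qfact_rec_nat[OF q(1), symmetric])
  finally show ?case
    using one_minus_power_nonzero[OF q(1), of "Suc s"] by (simp add: S_def del: power_Suc of_nat_Suc)
qed

lemma inv_qfact_convolution:
  fixes q :: complex
  assumes q: "norm q < 1" "q \<noteq> 0"
  shows "(\<Sum>k | 2 * k \<le> s. q ^ ((s - 2 * k) * (s - 2 * k - 1) div 2) / (qpoch q q (s - 2 * k) * qpoch (q ^ 2) (q ^ 2) k))
     = 1 / qpoch q q s"
proof -
  define t where "t = (\<lambda>k. q powi ((int s - 2 * int k) * (int s - 2 * int k - 1) div 2) * inv_qfact q (int s - 2 * int k) * inv_qfact (q ^ 2) (int k))"
  have "(\<Sum>k | 2 * k \<le> s. q ^ ((s - 2 * k) * (s - 2 * k - 1) div 2) / (qpoch q q (s - 2 * k) * qpoch (q ^ 2) (q ^ 2) k))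
      = (\<Sum>k | 2 * k \<le> s. t k)"
  proof (intro sum.cong refl)
    fix k assume "k \<in> {k. 2 * k \<le> s}"
    define i where "i = s - 2 * k"
    have i: "int s - 2 * int k = int i" using \<open>k \<in> _\<close> by (simp add: i_def)
    have "int i * (int i - 1) = int (i * (i - 1))" by (cases i) (simp_all add: algebra_simps)
    hence "int i * (int i - 1) div 2 = int (i * (i - 1) div 2)" by (simp only: zdiv_int of_nat_numeral)
    hence "q powi (int i * (int i - 1) div 2) = q ^ (i * (i - 1) div 2)" by (simp only: power_int_of_nat)
    thus "q ^ ((s - 2 * k) * (s - 2 * k - 1) div 2) / (qpoch q q (s - 2 * k) * qpoch (q ^ 2) (q ^ 2) k) = t k"
      unfolding t_def i i_def[symmetric] by (simp add: inv_qfact_nat)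
  qed
  also have "\<dots> = (\<Sum>k\<le>s. t k)"
    by (intro sum.mono_neutral_left) (auto simp: t_def not_le)
  also have "\<dots> = 1 / qpoch q q s"
    unfolding t_def by (subst inv_qfact_convolution_int) (use q in \<open>auto simp: inv_qfact_nat\<close>)
  finally show ?thesis .
qed

lemma summable_on_geometric_triple:
  fixes c :: real
  assumes "0 \<le> c" "c < 1"
  shows "(\<lambda>(i, j, k). c ^ (i + j + k)) summable_on (UNIV :: (nat \<times> nat \<times> nat) set)"
proof -
  have geo: "(\<lambda>n::nat. c ^ n) summable_on UNIV"
    using assms by (intro norm_summable_imp_summable_on) (auto intro!: summable_geometric)
  have prod: "(\<lambda>(x, y). f x * g y) summable_on UNIV"
    if f: "f summable_on UNIV" "\<And>x. f x \<ge> 0" and g: "g summable_on UNIV" "\<And>y. g y \<ge> 0"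
    for f :: "nat \<Rightarrow> real" and g :: "'b \<Rightarrow> real"
  proof -
    have "(\<lambda>(x, y). f x * g y) summable_on (SIGMA x:UNIV. UNIV)"
    proof (rule summable_on_SigmaI)
      show "((\<lambda>y. case (x, y) of (x, y) \<Rightarrow> f x * g y) has_sum f x * infsum g UNIV) UNIV" for x
        using g by (auto intro!: has_sum_cmult_right)
      show "(\<lambda>x. f x * infsum g UNIV) summable_on UNIV" by (intro summable_on_cmult_left f)
    qed (use f g in auto)
    thus ?thesis by simp
  qed
  have "(\<lambda>(i, y). c ^ i * (case y of (j, k) \<Rightarrow> c ^ j * c ^ k)) summable_on (UNIV :: (nat \<times> nat \<times> nat) set)"
    using assms by (intro prod geo) auto
  thus ?thesis by (rule summable_on_cong[THEN iffD1, rotated]) (auto simp: power_add)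
qed

text \<open>
  The common form of the three summands; the statements below have \<open>(a, b) = (0, 0), (0, 1), (1, 1)\<close>.
\<close>
definition triple_term :: "complex \<Rightarrow> nat \<Rightarrow> nat \<Rightarrow> nat \<times> nat \<times> nat \<Rightarrow> complex" where
  "triple_term q a b = (\<lambda>(i, j, k). let r = i + j + 2 * k in
     q ^ (r ^ 2 + a * r + (i * (i - 1) div 2 + (j ^ 2 + b * j)))
       / (qpoch q q i * qpoch q q j * qpoch (q ^ 2) (q ^ 2) k))"

text \<open>
  The exponent is at least \<open>r\<^sup>2 \<ge> r \<ge> i + j + k\<close> and the denominators are bounded away from \<open>0\<close>, so a triple
  geometric series is a majorant.
\<close>
lemma triple_term_summable:
  assumes q: "norm q < 1"
  shows "triple_term q a b summable_on UNIV"
proof (rule abs_summable_summable)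
  have q2: "norm (q ^ 2) < 1" using q by (simp add: norm_power power_less_one_iff)
  obtain C where C: "C > 0" "\<And>n. norm (inv_qfact q n) \<le> C"
    using inv_qfact_bounded[OF q] by blast
  obtain D where D: "D > 0" "\<And>n. norm (inv_qfact (q ^ 2) n) \<le> D"
    using inv_qfact_bounded[OF q2] by blast
  have "(\<lambda>p. (case p of (i, j, k) \<Rightarrow> norm q ^ (i + j + k)) * (C * C * D)) summable_on (UNIV :: (nat \<times> nat \<times> nat) set)"
    by (intro summable_on_cmult_left summable_on_geometric_triple) (use q in auto)
  thus "(\<lambda>p. norm (triple_term q a b p)) summable_on UNIV"
  proof (rule Infinite_Sum.abs_summable_on_comparison_test')
    fix p :: "nat \<times> nat \<times> nat"
    obtain i j k where p: "p = (i, j, k)" by (cases p) auto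
    define r where "r = i + j + 2 * k"
    define E where "E = r ^ 2 + a * r + (i * (i - 1) div 2 + (j ^ 2 + b * j))"
    have "r \<le> r ^ 2" by (simp add: power2_eq_square)
    hence "i + j + k \<le> E" unfolding E_def using r_def by linarith
    hence "norm q ^ E \<le> norm q ^ (i + j + k)" using q by (intro power_decreasing) auto
    moreover have "triple_term q a b p = q ^ E * (inv_qfact q (int i) * inv_qfact q (int j) * inv_qfact (q ^ 2) (int k))"
      by (simp add: triple_term_def p E_def r_def Let_def inv_qfact_nat)
    ultimately show "norm (triple_term q a b p) \<le> (case p of (i, j, k) \<Rightarrow> norm q ^ (i + j + k)) * (C * C * D)"
      unfolding p using C D by (simp only: norm_mult norm_power prod.case) (intro mult_mono; simp)
  qed
qed

lemma triple_term_fiber: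
  assumes q: "norm q < 1" "q \<noteq> 0"
  shows "(\<Sum>p | (case p of (i, j, k) \<Rightarrow> i + j + 2 * k) = r. triple_term q a b p)
     = q ^ r\<^sup>2 * (q ^ (a * r) * (\<Sum>j\<le>r. q ^ j\<^sup>2 * inv_qfact q (int r - int j) * (q ^ (b * j) * inv_qfact q (int j))))"
proof -
  define w where "w = (\<lambda>s k. q ^ ((s - 2 * k) * (s - 2 * k - 1) div 2) / (qpoch q q (s - 2 * k) * qpoch (q ^ 2) (q ^ 2) k))"
  have "(\<Sum>p | (case p of (i, j, k) \<Rightarrow> i + j + 2 * k) = r. triple_term q a b p)
      = (\<Sum>(j, k)\<in>(SIGMA j:{..r}. {k. 2 * k \<le> r - j}). q ^ (r\<^sup>2 + a * r) * (q ^ (j\<^sup>2 + b * j) / qpoch q q j) * w (r - j) k)"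
    by (rule sum.reindex_bij_witness[of _ "\<lambda>(j, k). (r - j - 2 * k, j, k)" "\<lambda>(i, j, k). (j, k)"])
       (auto simp: triple_term_def w_def Let_def power_add mult_ac)
  also have "\<dots> = (\<Sum>j\<le>r. \<Sum>k | 2 * k \<le> r - j. q ^ (r\<^sup>2 + a * r) * (q ^ (j\<^sup>2 + b * j) / qpoch q q j) * w (r - j) k)"
  proof (subst sum.Sigma)
    show "\<forall>j\<in>{..r}. finite {k. 2 * k \<le> r - j}"
      by (auto intro: finite_subset[of _ "{..r}"])
  qed auto
  also have "\<dots> = (\<Sum>j\<le>r. q ^ (r\<^sup>2 + a * r) * (q ^ (j\<^sup>2 + b * j) / qpoch q q j) * (1 / qpoch q q (r - j)))"
    unfolding sum_distrib_left[symmetric] w_def inv_qfact_convolution[OF q] ..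
  also have "\<dots> = q ^ r\<^sup>2 * (q ^ (a * r) * (\<Sum>j\<le>r. q ^ j\<^sup>2 * inv_qfact q (int r - int j) * (q ^ (b * j) * inv_qfact q (int j))))"
    unfolding sum_distrib_left
    by (intro sum.cong refl) (simp add: power_add inv_qfact_nat mult_ac flip: of_nat_diff)
  finally show ?thesis .
qed

text \<open>
  Absolute convergence permits summation by the finite fibres of \<open>r = i + j + 2 k\<close>.
\<close>
lemma triple_sum:
  assumes q: "norm q < 1" "q \<noteq> 0"
  shows "(triple_term q a b has_sum
     (\<Sum>\<^sub>\<infinity>r. q ^ r\<^sup>2 * (q ^ (a * r) * (\<Sum>j\<le>r. q ^ j\<^sup>2 * inv_qfact q (int r - int j) * (q ^ (b * j) * inv_qfact q (int j)))))) UNIV"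
proof -
  define S where "S = infsum (triple_term q a b) UNIV"
  define \<rho> :: "nat \<times> nat \<times> nat \<Rightarrow> nat" where "\<rho> = (\<lambda>(i, j, k). i + j + 2 * k)"
  have fin: "finite {p. \<rho> p = r}" for r
    by (rule finite_subset[of _ "{..r} \<times> {..r} \<times> {..r}"]) (auto simp: \<rho>_def)
  have S: "(triple_term q a b has_sum S) UNIV"
    unfolding S_def by (intro has_sum_infsum triple_term_summable q)
  also have "?this \<longleftrightarrow> ((\<lambda>(r, p). triple_term q a b p) has_sum S) (SIGMA r:UNIV. {p. \<rho> p = r})"
    by (rule has_sum_reindex_bij_witness[of _ snd "\<lambda>p. (\<rho> p, p)"]) auto
  finally have "((\<lambda>r. \<Sum>p | \<rho> p = r. triple_term q a b p) has_sum S) UNIV"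
    by (rule has_sum_Sigma') (auto intro!: has_sum_finiteI fin)
  hence "(\<Sum>\<^sub>\<infinity>r. \<Sum>p | \<rho> p = r. triple_term q a b p) = S" by (rule infsumI)
  with S show ?thesis unfolding \<rho>_def triple_term_fiber[OF q] by simp
qed

lemma triple_term_exponent:
  fixes i j k :: nat
  defines "r \<equiv> i + j + 2 * k"
  shows "(3 * i ^ 2 - i) div 2 + 2 * j ^ 2 + 4 * k ^ 2 + 2 * i * j + 4 * i * k + 4 * j * k
       = r ^ 2 + (i * (i - 1) div 2 + j ^ 2)" (is ?A)
   and "(3 * i ^ 2 + i) div 2 + 2 * j ^ 2 + 4 * k ^ 2 + 2 * i * j + 4 * i * k + 4 * j * k + 2 * j + 2 * k
       = r ^ 2 + r + (i * (i - 1) div 2 + (j ^ 2 + j))" (is ?B)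
proof -
  define t where "t = i * (i - 1) div 2"
  have t: "2 * t + i = i ^ 2"
    unfolding t_def by (cases i) (auto simp: power2_eq_square)
  have "3 * i ^ 2 - i = 2 * (i ^ 2 + t)" "3 * i ^ 2 + i = 2 * (i ^ 2 + t + i)" 
    unfolding t[symmetric] by simp_all
  hence "(3 * i ^ 2 - i) div 2 = i ^ 2 + t" "(3 * i ^ 2 + i) div 2 = i ^ 2 + t + i" by simp_all
  thus ?A ?B unfolding r_def t_def[symmetric] by (simp_all add: power2_eq_square algebra_simps)
qed

lemma triple_term_q0: "(triple_term 0 a b has_sum 1) UNIV"
proof (rule has_sum_finite_neutralI[of "{(0, 0, 0)}"])
  show "triple_term 0 a b p = 0" if "p \<in> UNIV - {(0, 0, 0)}" for p
    using that by (cases p) (auto simp: triple_term_def Let_def)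
qed (auto simp: triple_term_def qpoch_def Let_def)

lemma qpoch_inf_0 [simp]: "qpoch_inf 0 q = 1"
  by (simp add: qpoch_inf_def)

theorem theorem3p15:
  fixes q :: complex
  assumes "norm q < 1"
  shows
    "((\<lambda>(i, j, k).
         q ^ ((3 * i ^ 2 - i) div 2 + 2 * j ^ 2 + 4 * k ^ 2 + 2 * i * j + 4 * i * k + 4 * j * k)
         / (qpoch q q i * qpoch q q j * qpoch (q ^ 2) (q ^ 2) k))
       has_sum (qpoch_inf_list [q ^ 3, q ^ 4, q ^ 7] (q ^ 7) / qpoch_inf q q))
      (UNIV :: (nat \<times> nat \<times> nat) set) \<and>
     ((\<lambda>(i, j, k).
         q ^ ((3 * i ^ 2 - i) div 2 + 2 * j ^ 2 + 4 * k ^ 2 + 2 * i * j + 4 * i * k + 4 * j * k + j)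
         / (qpoch q q i * qpoch q q j * qpoch (q ^ 2) (q ^ 2) k))
       has_sum (qpoch_inf_list [q ^ 2, q ^ 5, q ^ 7] (q ^ 7) / qpoch_inf q q))
      (UNIV :: (nat \<times> nat \<times> nat) set) \<and>
     ((\<lambda>(i, j, k).
         q ^ ((3 * i ^ 2 + i) div 2 + 2 * j ^ 2 + 4 * k ^ 2 + 2 * i * j + 4 * i * k + 4 * j * k
              + 2 * j + 2 * k)
         / (qpoch q q i * qpoch q q j * qpoch (q ^ 2) (q ^ 2) k))
       has_sum (qpoch_inf_list [q, q ^ 6, q ^ 7] (q ^ 7) / qpoch_inf q q))
      (UNIV :: (nat \<times> nat \<times> nat) set)"
proof -
  have terms: "(\<lambda>(i, j, k).
         q ^ ((3 * i ^ 2 - i) div 2 + 2 * j ^ 2 + 4 * k ^ 2 + 2 * i * j + 4 * i * k + 4 * j * k)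
         / (qpoch q q i * qpoch q q j * qpoch (q ^ 2) (q ^ 2) k)) = triple_term q 0 0"
    "(\<lambda>(i, j, k).
         q ^ ((3 * i ^ 2 - i) div 2 + 2 * j ^ 2 + 4 * k ^ 2 + 2 * i * j + 4 * i * k + 4 * j * k + j)
         / (qpoch q q i * qpoch q q j * qpoch (q ^ 2) (q ^ 2) k)) = triple_term q 0 1"
    "(\<lambda>(i, j, k).
         q ^ ((3 * i ^ 2 + i) div 2 + 2 * j ^ 2 + 4 * k ^ 2 + 2 * i * j + 4 * i * k + 4 * j * k
              + 2 * j + 2 * k)
         / (qpoch q q i * qpoch q q j * qpoch (q ^ 2) (q ^ 2) k)) = triple_term q 1 1"
    unfolding triple_term_def Let_def triple_term_exponent by (simp_all add: add_ac)
  show ?thesis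
  proof (cases "q = 0")
    case True
    have "qpoch_inf_list [q ^ 3, q ^ 4, q ^ 7] (q ^ 7) / qpoch_inf q q = 1"
      "qpoch_inf_list [q ^ 2, q ^ 5, q ^ 7] (q ^ 7) / qpoch_inf q q = 1"
      "qpoch_inf_list [q, q ^ 6, q ^ 7] (q ^ 7) / qpoch_inf q q = 1"
      by (simp_all add: qpoch_inf_list_def True)
    thus ?thesis unfolding terms using triple_term_q0 True by simp
  next
    case False
    note q = assms False
    have q5: "norm (q ^ 5) < 1" using assms by (simp add: norm_power power_less_one_iff)
    note limit = bailey_limit_theta[OF q _ q5, where Q' = "q ^ 7"]
    have "(triple_term q 0 0 has_sum (\<Sum>\<^sub>\<infinity>r. q ^ r\<^sup>2 * bailey_sum q (theta_term (q ^ 3) (q ^ 5)) r)) UNIV"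
      using triple_sum[OF q, of 0 0] by (simp add: bailey_q3_5[OF q])
    also have "(\<Sum>\<^sub>\<infinity>r. q ^ r\<^sup>2 * bailey_sum q (theta_term (q ^ 3) (q ^ 5)) r)
        = qpoch_inf (q ^ 3) (q ^ 7) * qpoch_inf (q ^ 4) (q ^ 7) * qpoch_inf (q ^ 7) (q ^ 7) / qpoch_inf q q"
      using False by (intro limit) (auto simp flip: power_add power_Suc2)
    finally have 1: "(triple_term q 0 0 has_sum \<dots>) UNIV" .
    have "(triple_term q 0 1 has_sum (\<Sum>\<^sub>\<infinity>r. q ^ r\<^sup>2 * bailey_sum q (theta_term (q ^ 4) (q ^ 5)) r)) UNIV"
      using triple_sum[OF q, of 0 1] by (simp add: bailey_q4_5[OF q])
    also have "(\<Sum>\<^sub>\<infinity>r. q ^ r\<^sup>2 * bailey_sum q (theta_term (q ^ 4) (q ^ 5)) r)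
        = qpoch_inf (q ^ 2) (q ^ 7) * qpoch_inf (q ^ 5) (q ^ 7) * qpoch_inf (q ^ 7) (q ^ 7) / qpoch_inf q q"
      using False by (intro limit) (auto simp flip: power_add power_Suc2)
    finally have 2: "(triple_term q 0 1 has_sum \<dots>) UNIV" .
    have "(triple_term q 1 1 has_sum (\<Sum>\<^sub>\<infinity>r. q ^ r\<^sup>2 * bailey_sum q (theta_term (q ^ 5) (q ^ 5)) r)) UNIV"
      using triple_sum[OF q, of 1 1] by (simp add: bailey_q5_5[OF q])
    also have "(\<Sum>\<^sub>\<infinity>r. q ^ r\<^sup>2 * bailey_sum q (theta_term (q ^ 5) (q ^ 5)) r)
        = qpoch_inf q (q ^ 7) * qpoch_inf (q ^ 6) (q ^ 7) * qpoch_inf (q ^ 7) (q ^ 7) / qpoch_inf q q"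
      using False by (intro limit) (auto simp flip: power_add power_Suc2)
    finally have 3: "(triple_term q 1 1 has_sum \<dots>) UNIV" .
    show ?thesis unfolding terms using 1 2 3 by (simp add: qpoch_inf_list_def mult_ac)
  qed
qed

end
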